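(* Let $G$ be a compactly generated locally compact group. (1) If $\mathcal{F}$ is a filtering family of closed normal subgroups of $G$, then there exist $N\in\mathcal{F}$ and a closed normal subgroup $K$ of $G$ such that $\bigcap\mathcal{F}\le K\le N$, $K/\bigcap\mathcal{F}$ is compact, and $N/K$ is discrete. (2) If $\mathcal{D}$ is a directed family of closed normal subgroups of $G$, then there exist $N\in\mathcal{D}$ and a closed normal subgroup $K$ of $G$ such that $N\le K\le\overline{\langle\bigcup\mathcal{D}\rangle}$, $K/N$ is compact, and $\overline{\langle\bigcup\mathcal{D}\rangle}/K$ is discrete.
   Context: A family $\mathcal{F}$ of closed normal subgroups is filtering if for all $N,M\in\mathcal{F}$ there is $L\in\mathcal{F}$ with $L\le N\cap M$; a family $\mathcal{D}$ is directed if for all $N,M\in\mathcal{D}$ there is $L\in\mathcal{D}$ with $N\cup M\subseteq L$. $\overline{\langle\bigcup\mathcal{D}\rangle}$ denotes the closed subgroup generated by the union of the members of $\mathcal{D}$. All groups are Hausdorff. *)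

theory Defs
  imports "HOL-Analysis.Analysis" "HOL-Algebra.Coset" "HOL-Algebra.Generated_Groups"
begin

definition topological_group :: "('a, 'b) monoid_scheme \<Rightarrow> 'a topology \<Rightarrow> bool" where
  "topological_group G T \<longleftrightarrow> group G \<and> topspace T = carrier G \<and>
     continuous_map (prod_topology T T) T (\<lambda>(x, y). x \<otimes>\<^bsub>G\<^esub> y) \<and>
     continuous_map T T (\<lambda>x. inv\<^bsub>G\<^esub> x) \<and> Hausdorff_space T"

definition locally_compact_group :: "('a, 'b) monoid_scheme \<Rightarrow> 'a topology \<Rightarrow> bool" where
  "locally_compact_group G T \<longleftrightarrow> topological_group G T \<and> locally_compact_space T"

definition compactly_generated :: "('a, 'b) monoid_scheme \<Rightarrow> 'a topology \<Rightarrow> bool" where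
  "compactly_generated G T \<longleftrightarrow> (\<exists>C. compactin T C \<and> generate G C = carrier G)"

definition closed_normal_subgroup :: "('a, 'b) monoid_scheme \<Rightarrow> 'a topology \<Rightarrow> 'a set \<Rightarrow> bool" where
  "closed_normal_subgroup G T N \<longleftrightarrow> closedin T N \<and> N \<lhd> G"

definition quotient_topology :: "'a topology \<Rightarrow> ('a \<Rightarrow> 'c) \<Rightarrow> 'c topology" where
  "quotient_topology X f =
     topology (\<lambda>U. U \<subseteq> f ` topspace X \<and> openin X {x \<in> topspace X. f x \<in> U})"

definition coset_space :: "('a, 'b) monoid_scheme \<Rightarrow> 'a topology \<Rightarrow> 'a set \<Rightarrow> 'a set \<Rightarrow> 'a set topology" where
  "coset_space G T K L = quotient_topology (subtopology T K) (\<lambda>x. L #>\<^bsub>G\<^esub> x)"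

definition discrete_space :: "'c topology \<Rightarrow> bool" where
  "discrete_space X \<longleftrightarrow> X = discrete_topology (topspace X)"

definition filtering :: "'a set set \<Rightarrow> bool" where
  "filtering \<F> \<longleftrightarrow> (\<forall>N\<in>\<F>. \<forall>M\<in>\<F>. \<exists>L\<in>\<F>. L \<subseteq> N \<inter> M)"

definition directed :: "'a set set \<Rightarrow> bool" where
  "directed \<D> \<longleftrightarrow> (\<forall>N\<in>\<D>. \<forall>M\<in>\<D>. \<exists>L\<in>\<D>. N \<union> M \<subseteq> L)"

end

(* Choose identity neighbourhoods W and V with V inside a compact set B such that W W^{-1} and all
   conjugates of W by elements of a compact symmetric generating set lie in V. If P and L are closed
   normal subgroups with P <= L and L \<inter> B \<subseteq> W P, then L \<inter> V P = L \<inter> W P, so this set is closed under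
   division and under conjugation by generators: it is a normal subgroup of G, open in L and compact
   modulo P. In both parts a compactness argument on B provides the inclusion L \<inter> B \<subseteq> W P: with
   P = \<Inter>F and L = N for a small N in part (1), with P = N for a large N and L the closed union
   in part (2). *)
theory Submission
  imports Defs
begin

section \<open>Directed covers of compact sets, and the quotient topology\<close>

text \<open>A finite subcover exists by compactness, and directedness absorbs its members one at a
  time into a single \<open>U k\<close>. That \<open>I\<close> is non-empty supplies an index when
  the subcover is empty.\<close>

lemma compactin_directed_cover:
  assumes "compactin X B" and "I \<noteq> {}"
    and "\<And>i. i \<in> I \<Longrightarrow> openin X (U i)"
    and dir: "\<And>i j. i \<in> I \<Longrightarrow> j \<in> I \<Longrightarrow> \<exists>k\<in>I. U i \<union> U j \<subseteq> U k"
    and cover: "B \<subseteq> (\<Union>i\<in>I. U i)"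
  obtains k where "k \<in> I" "B \<subseteq> U k"
proof -
  have "\<exists>\<G>. finite \<G> \<and> \<G> \<subseteq> U ` I \<and> B \<subseteq> \<Union>\<G>"
    using assms(1,3) cover unfolding compactin_def by (metis imageE)
  then obtain J where J: "finite J" "J \<subseteq> I" "B \<subseteq> (\<Union>i\<in>J. U i)"
    by (metis finite_subset_image)
  have "\<exists>k\<in>I. (\<Union>i\<in>J. U i) \<subseteq> U k"
    using J(1,2)
  proof (induction J rule: finite_induct)
    case empty
    then show ?case using \<open>I \<noteq> {}\<close> by auto
  next
    case (insert j J)
    then obtain k where "k \<in> I" "(\<Union>i\<in>J. U i) \<subseteq> U k" by auto
    moreover obtain l where "l \<in> I" "U j \<union> U k \<subseteq> U l"
      using dir insert.prems \<open>k \<in> I\<close> by (meson insert_subset)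
    ultimately show ?case by (intro bexI[of _ l]) auto
  qed
  then obtain k where "k \<in> I" "(\<Union>i\<in>J. U i) \<subseteq> U k" by (elim bexE)
  with J(3) show thesis by (meson that subset_trans)
qed

text \<open>\<open>topology\<close> only returns the given predicate as open sets once
  \<open>istopology\<close> is known. This holds because preimages commute with intersections and
  unions.\<close>

lemma openin_quotient_topology:
  "openin (quotient_topology X f) U \<longleftrightarrow>
     U \<subseteq> f ` topspace X \<and> openin X {x \<in> topspace X. f x \<in> U}"
proof -
  have "istopology (\<lambda>U. U \<subseteq> f ` topspace X \<and> openin X {x \<in> topspace X. f x \<in> U})"
    unfolding istopology_def
  proof (intro conjI allI impI; (elim conjE)?)
    fix S T
    assume "openin X {x \<in> topspace X. f x \<in> S}" "openin X {x \<in> topspace X. f x \<in> T}"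
    then have "openin X ({x \<in> topspace X. f x \<in> S} \<inter> {x \<in> topspace X. f x \<in> T})" by blast
    moreover have "{x \<in> topspace X. f x \<in> S} \<inter> {x \<in> topspace X. f x \<in> T} =
        {x \<in> topspace X. f x \<in> S \<inter> T}" by blast
    ultimately show "openin X {x \<in> topspace X. f x \<in> S \<inter> T}" by simp
  next
    fix \<K>
    assume "\<forall>S\<in>\<K>. S \<subseteq> f ` topspace X \<and> openin X {x \<in> topspace X. f x \<in> S}"
    then have "openin X (\<Union>S\<in>\<K>. {x \<in> topspace X. f x \<in> S})" by blast
    moreover have "(\<Union>S\<in>\<K>. {x \<in> topspace X. f x \<in> S}) = {x \<in> topspace X. f x \<in> \<Union>\<K>}" by blast
    ultimately show "openin X {x \<in> topspace X. f x \<in> \<Union>\<K>}" by simp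
  qed auto
  then show ?thesis
    unfolding quotient_topology_def by (simp add: topology_inverse')
qed

lemma topspace_quotient_topology: "topspace (quotient_topology X f) = f ` topspace X"
proof -
  have "{x \<in> topspace X. f x \<in> f ` topspace X} = topspace X" by auto
  then have "openin (quotient_topology X f) (f ` topspace X)"
    by (simp add: openin_quotient_topology)
  then show ?thesis
    by (metis openin_quotient_topology openin_subset openin_topspace subset_antisym)
qed

lemma continuous_map_quotient_topology: "continuous_map X (quotient_topology X f) f"
  by (auto simp: continuous_map_def openin_quotient_topology topspace_quotient_topology)

section \<open>Open translates and relatively open subgroups of a topological group\<close>

locale topological_grp = group G for G :: "('a, 'b) monoid_scheme" (structure) +
  fixes T :: "'a topology"
  assumes topological_group: "topological_group G T"
begin

lemma topspace_eq: "topspace T = carrier G"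
  using topological_group by (simp add: topological_group_def)

lemma continuous_map_mult:
  assumes "continuous_map X T f" "continuous_map X T g"
  shows "continuous_map X T (\<lambda>x. f x \<otimes> g x)"
proof -
  have "continuous_map (prod_topology T T) T (\<lambda>(x, y). x \<otimes> y)"
    using topological_group by (simp add: topological_group_def)
  with continuous_map_pairedI[OF assms]
  have "continuous_map X T ((\<lambda>(x, y). x \<otimes> y) \<circ> (\<lambda>x. (f x, g x)))"
    by (rule continuous_map_compose)
  then show ?thesis by (simp add: o_def)
qed

lemma continuous_map_inv:
  assumes "continuous_map X T f"
  shows "continuous_map X T (\<lambda>x. inv (f x))"
proof -
  have "continuous_map T T (\<lambda>x. inv x)"
    using topological_group by (simp add: topological_group_def)
  with assms have "continuous_map X T ((\<lambda>x. inv x) \<circ> f)"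
    by (rule continuous_map_compose)
  then show ?thesis by (simp add: o_def)
qed

lemma inv_mult_cancel: "x \<in> carrier G \<Longrightarrow> z \<in> carrier G \<Longrightarrow> inv x \<otimes> (x \<otimes> z) = z"
  by (simp flip: m_assoc)

lemma continuous_map_constant: "c \<in> carrier G \<Longrightarrow> continuous_map X T (\<lambda>x. c)"
  by (simp add: topspace_eq)

lemmas continuous_intros_grp =
  continuous_map_mult continuous_map_inv continuous_map_constant
  continuous_map_fst continuous_map_snd continuous_map_id[unfolded id_def]

text \<open>\<open>W <#> S\<close> is a union of right translates of \<open>W\<close>, each written
  as the preimage of \<open>W\<close> under the continuous map
  \<open>x \<mapsto> x \<otimes> inv s\<close>.\<close>

lemma openin_set_mult:
  assumes W: "openin T W" and S: "S \<subseteq> carrier G"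
  shows "openin T (W <#> S)"
proof -
  have WG: "W \<subseteq> carrier G" using openin_subset[OF W] by (simp add: topspace_eq)
  have "openin T (\<Union>s\<in>S. {x \<in> topspace T. x \<otimes> inv s \<in> W})"
    using S by (intro openin_Union ballI)
      (auto intro!: openin_continuous_map_preimage[OF _ W] continuous_intros_grp)
  moreover have "W <#> S = (\<Union>s\<in>S. {x \<in> topspace T. x \<otimes> inv s \<in> W})"
  proof (intro Set.set_eqI iffI)
    fix x assume "x \<in> W <#> S"
    then obtain w s where "w \<in> W" "s \<in> S" "x = w \<otimes> s" by (auto simp: set_mult_def)
    then show "x \<in> (\<Union>s\<in>S. {x \<in> topspace T. x \<otimes> inv s \<in> W})"
      using WG S by (intro UN_I[of s]) (auto simp: topspace_eq m_assoc subset_iff)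
  next
    fix x assume "x \<in> (\<Union>s\<in>S. {x \<in> topspace T. x \<otimes> inv s \<in> W})"
    then obtain s where s: "s \<in> S" "x \<in> carrier G" "x \<otimes> inv s \<in> W" by (auto simp: topspace_eq)
    moreover have "x = (x \<otimes> inv s) \<otimes> s" using s S by (auto simp: m_assoc subset_iff)
    ultimately show "x \<in> W <#> S" unfolding set_mult_def by blast
  qed
  ultimately show ?thesis by simp
qed

lemma openin_l_coset:
  assumes "openin T U" "x \<in> carrier G"
  shows "openin T (x <# U)"
proof -
  have UG: "U \<subseteq> carrier G" using openin_subset[OF assms(1)] by (simp add: topspace_eq)
  have "openin T {y \<in> topspace T. inv x \<otimes> y \<in> U}"
    using assms by (auto intro!: openin_continuous_map_preimage[OF _ assms(1)] continuous_intros_grp)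
  moreover have "x <# U = {y \<in> topspace T. inv x \<otimes> y \<in> U}"
  proof (intro Set.set_eqI iffI)
    fix y assume "y \<in> x <# U"
    then show "y \<in> {y \<in> topspace T. inv x \<otimes> y \<in> U}"
      using assms(2) UG by (auto simp: l_coset_def topspace_eq subset_iff simp flip: m_assoc)
  next
    fix y assume y: "y \<in> {y \<in> topspace T. inv x \<otimes> y \<in> U}"
    then have "y = x \<otimes> (inv x \<otimes> y)" using assms(2) by (simp add: topspace_eq flip: m_assoc)
    with y show "y \<in> x <# U" unfolding l_coset_def by blast
  qed
  ultimately show ?thesis by simp
qed

text \<open>This is the argument that open subgroups are closed, relative to \<open>L\<close>. Only
  \<open>L \<inter> U\<close> is a subgroup, so translates of \<open>U\<close> may leave
  \<open>L\<close>; it suffices that they avoid \<open>L \<inter> U\<close>.\<close>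

lemma closedin_subgroup_if_rel_open:
  assumes "closedin T L" "subgroup L G" "openin T U" "subgroup (L \<inter> U) G"
  shows "closedin T (L \<inter> U)"
proof -
  have LG: "L \<subseteq> carrier G" using assms(2) by (rule subgroup.subset)
  have one: "\<one> \<in> U" using subgroup.one_closed[OF assms(4)] by simp
  define O' where "O' = (topspace T - L) \<union> (\<Union>x\<in>L - U. x <# U)"
  have "openin T O'"
    unfolding O'_def using assms(1,3) LG
    by (intro openin_Un openin_Union) (auto intro: openin_l_coset)
  moreover have "L \<inter> U = topspace T - O'"
  proof (intro Set.set_eqI iffI)
    fix y assume y: "y \<in> L \<inter> U"
    \<comment> \<open>If y = x u with u in U, then u = x^{-1} y lies in L, hence in the subgroup
      \<open>L \<inter> U\<close>, and x = y u^{-1} would lie in U.\<close>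
    have "y \<notin> x <# U" if x: "x \<in> L - U" for x
    proof
      assume "y \<in> x <# U"
      then obtain u where u: "u \<in> U" "y = x \<otimes> u" by (auto simp: l_coset_def)
      have uG: "u \<in> carrier G" using u(1) openin_subset[OF assms(3)] by (auto simp: topspace_eq)
      have "u = inv x \<otimes> y" using u uG x LG by (auto simp: subset_iff simp flip: m_assoc)
      then have "u \<in> L \<inter> U"
        using u(1) x y assms(2) by (auto intro: subgroup.m_closed subgroup.m_inv_closed)
      then have "y \<otimes> inv u \<in> L \<inter> U"
        using y assms(4) by (meson subgroup.m_closed subgroup.m_inv_closed)
      moreover have "y \<otimes> inv u = x" using u uG x LG by (auto simp: m_assoc subset_iff)
      ultimately show False using x by simp
    qed
    then show "y \<in> topspace T - O'" using y LG by (auto simp: O'_def topspace_eq)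
  next
    fix y assume y: "y \<in> topspace T - O'"
    then have "y \<in> L" by (auto simp: O'_def)
    moreover have "y \<in> U"
    proof (rule ccontr)
      assume "y \<notin> U"
      moreover have "y \<in> y <# U"
        unfolding l_coset_def using one \<open>y \<in> L\<close> LG by (auto intro!: bexI[of _ \<one>])
      ultimately show False using y \<open>y \<in> L\<close> by (auto simp: O'_def)
    qed
    ultimately show "y \<in> L \<inter> U" by simp
  qed
  ultimately show ?thesis by (simp add: closedin_def) (metis Diff_Diff_Int Diff_subset inf.absorb_iff2 openin_subset)
qed

section \<open>Discreteness and compactness of coset spaces\<close>

text \<open>Each coset \<open>K #> x\<close> with \<open>x\<close> in \<open>L\<close> is the trace
  on \<open>L\<close> of the open translate \<open>U #> x\<close>, so cosets are open in
  \<open>L\<close>.\<close>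

lemma discrete_coset_space:
  assumes L: "subgroup L G" and K: "subgroup K G" "K \<subseteq> L" and U: "openin T U" "K = L \<inter> U"
  shows "discrete_space (coset_space G T L K)"
proof -
  have LG: "L \<subseteq> carrier G" using L by (rule subgroup.subset)
  have topL: "topspace (subtopology T L) = L" using LG by (auto simp: topspace_eq)
  have coset: "K #> x = L \<inter> (U #> x)" if x: "x \<in> L" for x
  proof (intro Set.set_eqI iffI)
    fix y assume "y \<in> K #> x"
    then show "y \<in> L \<inter> (U #> x)"
      using x L U(2) by (auto simp: r_coset_def intro: subgroup.m_closed)
  next
    fix y assume y: "y \<in> L \<inter> (U #> x)"
    then obtain u where u: "u \<in> U" "y = u \<otimes> x" by (auto simp: r_coset_def)
    have uG: "u \<in> carrier G" using u(1) openin_subset[OF U(1)] by (auto simp: topspace_eq)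
    have "u = y \<otimes> inv x" using u uG x LG by (auto simp: m_assoc subset_iff)
    then have "u \<in> L" using x y L by (auto intro: subgroup.m_closed subgroup.m_inv_closed)
    then show "y \<in> K #> x" using u U(2) by (auto simp: r_coset_def)
  qed
  have "openin (subtopology T L) (K #> x)" if x: "x \<in> L" for x
  proof -
    have "U #> x = U <#> {x}" by (auto simp: r_coset_def set_mult_def)
    then have "openin T (U #> x)" using openin_set_mult[OF U(1)] x LG by auto
    then show ?thesis using coset[OF x] by (auto simp: openin_subtopology)
  qed
  \<comment> \<open>The preimage of an arbitrary set \<open>S\<close> of cosets contains, with each
    point, the whole open coset of that point.\<close>
  then have "openin (subtopology T L) {x \<in> L. K #> x \<in> S}" for S
    using rcos_self[OF _ K(1)] repr_independence[OF _ _ K(1)] LG coset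
    by (subst openin_subopen) (smt (verit) IntD1 mem_Collect_eq subset_iff)
  then show ?thesis
    unfolding discrete_space_def coset_space_def topology_eq
    by (auto simp: openin_quotient_topology topspace_quotient_topology topL
        simp del: topspace_subtopology)
qed

text \<open>Every coset of \<open>P\<close> in \<open>K\<close> has a representative in
  \<open>Q\<close>, so the coset space is the continuous image of a compact set.\<close>

lemma compact_coset_space:
  assumes K: "K \<subseteq> carrier G" and Q: "compactin T Q" "Q \<subseteq> K"
    and P: "P \<lhd> G" and KP: "K \<subseteq> Q <#> P"
  shows "compact_space (coset_space G T K P)"
proof -
  let ?f = "\<lambda>x. P #> x" and ?X = "subtopology T K"
  have "topspace ?X = K" using K by (auto simp: topspace_eq)
  have "?f ` K \<subseteq> ?f ` Q"
  proof (rule image_subsetI)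
    fix x assume "x \<in> K"
    then obtain q p where qp: "q \<in> Q" "p \<in> P" "x = q \<otimes> p" using KP by (auto simp: set_mult_def)
    have "q \<in> carrier G" "p \<in> carrier G"
      using qp Q K normal_imp_subgroup[OF P] subgroup.subset by blast+
    \<comment> \<open>The factorisation has P on the right, whereas the points of the coset space
      are cosets \<open>P #> q\<close>; normality moves p to the left of q.\<close>
    moreover have "q \<otimes> p \<otimes> inv q \<in> P" using P qp \<open>q \<in> carrier G\<close> by (simp add: normal.inv_op_closed2)
    ultimately have "x \<in> P #> q"
      unfolding r_coset_def using qp by (auto intro!: bexI[of _ "q \<otimes> p \<otimes> inv q"] simp: m_assoc)
    then have "?f x = ?f q"
      using repr_independence normal_imp_subgroup[OF P] \<open>q \<in> carrier G\<close> by metis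
    with qp show "?f x \<in> ?f ` Q" by blast
  qed
  then have "?f ` Q = ?f ` K" using Q by blast
  moreover have "compactin (quotient_topology ?X ?f) (?f ` Q)"
    using Q by (intro image_compactin[where X = ?X] continuous_map_quotient_topology) (simp add: compactin_subtopology)
  ultimately show ?thesis
    by (simp add: compact_space_def coset_space_def topspace_quotient_topology \<open>topspace ?X = K\<close>
        del: topspace_subtopology)
qed

section \<open>Construction of the intermediate normal subgroup\<close>

text \<open>Induction on words in the generators. Inverse generators are included because c K c^{-1}
  could be properly contained in K, which says nothing about c^{-1} K c.\<close>

lemma normalI_generators:
  assumes K: "subgroup K G" and gen: "generate G C = carrier G" and C: "C \<subseteq> carrier G"
    and conj: "\<And>c k. c \<in> C \<union> m_inv G ` C \<Longrightarrow> k \<in> K \<Longrightarrow> c \<otimes> k \<otimes> inv c \<in> K"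
  shows "K \<lhd> G"
proof (rule normal_invI[OF K])
  fix g k assume g: "g \<in> carrier G" and k: "k \<in> K"
  have KG: "K \<subseteq> carrier G" using K by (rule subgroup.subset)
  from g have "g \<in> generate G C" by (simp add: gen)
  then show "g \<otimes> k \<otimes> inv g \<in> K" using k
  proof (induction arbitrary: k)
    case one
    then show ?case using KG by auto
  next
    case (eng a b)
    have "a \<in> carrier G" "b \<in> carrier G" "k \<in> carrier G" using eng KG gen by auto
    then have "a \<otimes> b \<otimes> k \<otimes> inv (a \<otimes> b) = a \<otimes> (b \<otimes> k \<otimes> inv b) \<otimes> inv a"
      by (simp add: inv_mult_group m_assoc)
    with eng show ?case by simp
  qed (use conj in auto)
qed

text \<open>Local compactness at the identity gives \<open>V\<close> and \<open>B\<close>.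
  Continuity of division at the identity pair handles quotients, and the tube lemma makes
  conjugation small uniformly over the compact set \<open>C\<close>.\<close>

lemma exists_core_nbhds:
  assumes lc: "locally_compact_space T" and C: "compactin T C"
  obtains V W B where "openin T W" "\<one> \<in> W" "compactin T B" "V \<subseteq> B" "W \<subseteq> V"
    and "\<And>x y. x \<in> W \<Longrightarrow> y \<in> W \<Longrightarrow> x \<otimes> inv y \<in> V"
    and "\<And>c x. c \<in> C \<Longrightarrow> x \<in> W \<Longrightarrow> c \<otimes> x \<otimes> inv c \<in> V"
proof -
  obtain V B where V: "openin T V" "\<one> \<in> V" "compactin T B" "V \<subseteq> B"
    using lc by (metis locally_compact_space_def one_closed topspace_eq)
  have CG: "C \<subseteq> carrier G" using compactin_subset_topspace[OF C] by (simp add: topspace_eq)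
  define D where "D = {z \<in> topspace (prod_topology T T). fst z \<otimes> inv (snd z) \<in> V}"
  have D: "openin (prod_topology T T) D"
    unfolding D_def by (intro openin_continuous_map_preimage[OF _ V(1)] continuous_intros_grp)
  have "(\<one>, \<one>) \<in> D" using V by (simp add: D_def topspace_eq)
  with D have "\<exists>W1 W2. openin T W1 \<and> openin T W2 \<and> \<one> \<in> W1 \<and> \<one> \<in> W2 \<and> W1 \<times> W2 \<subseteq> D"
    by (simp add: openin_prod_topology_alt)
  then obtain W1 W2 where W12: "openin T W1" "openin T W2" "\<one> \<in> W1" "\<one> \<in> W2" "W1 \<times> W2 \<subseteq> D"
    by (elim exE conjE)
  \<comment> \<open>The conjugating element is the second coordinate, so the compact slice
    \<open>{\<one>} \<times> C\<close> lies in \<open>E\<close> and the tube lemma yields a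
    neighbourhood \<open>W3\<close> valid for all of \<open>C\<close>.\<close>
  define E where "E = {z \<in> topspace (prod_topology T T). snd z \<otimes> fst z \<otimes> inv (snd z) \<in> V}"
  have E: "openin (prod_topology T T) E"
    unfolding E_def by (intro openin_continuous_map_preimage[OF _ V(1)] continuous_intros_grp)
  have "{\<one>} \<times> C \<subseteq> E" using V CG by (auto simp: E_def topspace_eq)
  with tube_lemma_right[OF E C, of "\<one>"] obtain W3 V' where
    W3: "openin T W3" "\<one> \<in> W3" "C \<subseteq> V'" "W3 \<times> V' \<subseteq> E" unfolding topspace_eq by blast
  show thesis
  proof (rule that)
    let ?W = "V \<inter> W1 \<inter> W2 \<inter> W3"
    show "openin T ?W" "\<one> \<in> ?W" using V W12 W3 by auto
    show "compactin T B" "V \<subseteq> B" "?W \<subseteq> V" using V by auto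
    show "x \<otimes> inv y \<in> V" if "x \<in> ?W" "y \<in> ?W" for x y
    proof -
      have "(x, y) \<in> D" using W12(5) that by blast
      then show ?thesis by (simp add: D_def)
    qed
    show "c \<otimes> x \<otimes> inv c \<in> V" if "c \<in> C" "x \<in> ?W" for c x
    proof -
      have "(x, c) \<in> E" using W3(3,4) that by blast
      then show ?thesis by (simp add: E_def)
    qed
  qed
qed

lemma compact_by_discrete:
  assumes W: "openin T W" "\<one> \<in> W" "W \<subseteq> V" and B: "compactin T B" "V \<subseteq> B"
    and div: "\<And>x y. x \<in> W \<Longrightarrow> y \<in> W \<Longrightarrow> x \<otimes> inv y \<in> V"
    and conj: "\<And>c x. c \<in> C \<union> m_inv G ` C \<Longrightarrow> x \<in> W \<Longrightarrow> c \<otimes> x \<otimes> inv c \<in> V"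
    and C: "C \<subseteq> carrier G" "generate G C = carrier G"
    and P: "closed_normal_subgroup G T P" and L: "closed_normal_subgroup G T L" and "P \<subseteq> L"
    and sub: "L \<inter> B \<subseteq> W <#> P"
  shows "\<exists>K. closed_normal_subgroup G T K \<and> P \<subseteq> K \<and> K \<subseteq> L \<and>
    compact_space (coset_space G T K P) \<and> discrete_space (coset_space G T L K)"
proof -
  define K where "K = L \<inter> (W <#> P)"
  have nP: "P \<lhd> G" and nL: "L \<lhd> G" and clL: "closedin T L"
    using P L by (auto simp: closed_normal_subgroup_def)
  have sP: "subgroup P G" and sL: "subgroup L G" using nP nL by (simp_all add: normal_imp_subgroup)
  have PG: "P \<subseteq> carrier G" and LG: "L \<subseteq> carrier G" using sP sL by (simp_all add: subgroup.subset)
  have BG: "B \<subseteq> carrier G" using compactin_subset_topspace[OF B(1)] by (simp add: topspace_eq)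
  have VG: "V \<subseteq> carrier G" and WG: "W \<subseteq> carrier G" using BG B W by auto
  have opW: "openin T (W <#> P)" using W(1) PG by (rule openin_set_mult)
  have "P \<subseteq> W <#> P"
  proof
    fix p assume "p \<in> P"
    then have "p = \<one> \<otimes> p" using PG by auto
    then show "p \<in> W <#> P" unfolding set_mult_def using \<open>p \<in> P\<close> W(2) by blast
  qed
  then have PK: "P \<subseteq> K" using \<open>P \<subseteq> L\<close> by (auto simp: K_def)
  \<comment> \<open>Since P lies in L, the W-factor of an element of K is itself in L.\<close>
  have KQP: "K \<subseteq> (L \<inter> W) <#> P"
  proof
    fix x assume x: "x \<in> K"
    then obtain w p where wp: "w \<in> W" "p \<in> P" "x = w \<otimes> p" by (auto simp: K_def set_mult_def)
    have "w = x \<otimes> inv p" using wp WG PG by (auto simp: m_assoc subset_iff)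
    also have "\<dots> \<in> L"
      using x wp \<open>P \<subseteq> L\<close> sL by (auto simp: K_def intro!: subgroup.m_closed subgroup.m_inv_closed)
    finally show "x \<in> (L \<inter> W) <#> P" using wp by (auto simp: set_mult_def)
  qed
  \<comment> \<open>Division and conjugation enlarge W to V; this returns the result to W P. The
    factor v lies in \<open>L \<inter> B\<close>, where \<open>sub\<close> applies, and the two
    P-factors merge.\<close>
  have VP: "v \<otimes> p \<in> K" if "v \<in> V" "p \<in> P" "v \<otimes> p \<in> L" for v p
  proof -
    have G: "v \<in> carrier G" "p \<in> carrier G" using that VG PG by auto
    have "v = (v \<otimes> p) \<otimes> inv p" using G by (simp add: m_assoc)
    also have "\<dots> \<in> L"
      using that \<open>P \<subseteq> L\<close> sL by (auto intro!: subgroup.m_closed subgroup.m_inv_closed)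
    finally have "v \<in> W <#> P" using sub that(1) B(2) by blast
    then obtain w q where wq: "w \<in> W" "q \<in> P" "v = w \<otimes> q" by (auto simp: set_mult_def)
    have "v \<otimes> p = w \<otimes> (q \<otimes> p)" using wq WG PG G by (auto simp: m_assoc subset_iff)
    moreover have "q \<otimes> p \<in> P" using wq that sP by (simp add: subgroup.m_closed)
    ultimately show ?thesis using that(3) wq(1) by (auto simp: K_def set_mult_def)
  qed
  have sK: "subgroup K G"
  proof (rule subgroupI)
    have div_K: "x \<otimes> inv y \<in> K" if xy: "x \<in> K" "y \<in> K" for x y
    proof -
      obtain w p where wp: "w \<in> W" "p \<in> P" "x = w \<otimes> p" using xy by (auto simp: K_def set_mult_def)
      obtain u q where uq: "u \<in> W" "q \<in> P" "y = u \<otimes> q" using xy by (auto simp: K_def set_mult_def)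
      have G: "w \<in> carrier G" "p \<in> carrier G" "u \<in> carrier G" "q \<in> carrier G"
        using wp uq WG PG by auto
      have "p \<otimes> inv q \<in> P" using wp uq sP by (simp add: subgroup.m_closed subgroup.m_inv_closed)
      then have "u \<otimes> (p \<otimes> inv q) \<otimes> inv u \<in> P" using nP G by (simp add: normal.inv_op_closed2)
      \<comment> \<open>Conjugating by u pushes the P-part to the right and leaves w u^{-1}, which
        \<open>div\<close> places in V.\<close>
      moreover have "x \<otimes> inv y = (w \<otimes> inv u) \<otimes> (u \<otimes> (p \<otimes> inv q) \<otimes> inv u)"
        using wp uq G by (simp add: m_assoc inv_mult_group inv_mult_cancel)
      moreover have "x \<otimes> inv y \<in> L"
        using xy sL by (simp add: K_def subgroup.m_closed subgroup.m_inv_closed)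
      ultimately show ?thesis using VP div wp(1) uq(1) by metis
    qed
    have one: "\<one> \<in> K" using PK sP subgroup.one_closed by blast
    show KG: "K \<subseteq> carrier G" using LG by (auto simp: K_def)
    show "K \<noteq> {}" using one by blast
    show inv_K: "inv a \<in> K" if "a \<in> K" for a
      using div_K[OF one that] KG that by auto
    show "a \<otimes> b \<in> K" if "a \<in> K" "b \<in> K" for a b
      using div_K[OF that(1) inv_K[OF that(2)]] KG that by auto
  qed
  have nK: "K \<lhd> G"
  proof (rule normalI_generators[OF sK C(2,1)])
    fix c x assume c: "c \<in> C \<union> m_inv G ` C" and x: "x \<in> K"
    obtain w p where wp: "w \<in> W" "p \<in> P" "x = w \<otimes> p" using x by (auto simp: K_def set_mult_def)
    have G: "w \<in> carrier G" "p \<in> carrier G" "c \<in> carrier G" using wp WG PG c C(1) by auto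
    have "c \<otimes> p \<otimes> inv c \<in> P" using nP G wp by (simp add: normal.inv_op_closed2)
    \<comment> \<open>The first factor is in V by the choice of W, the second in P by
      normality.\<close>
    moreover have "c \<otimes> x \<otimes> inv c = (c \<otimes> w \<otimes> inv c) \<otimes> (c \<otimes> p \<otimes> inv c)"
      using wp G by (simp add: m_assoc inv_mult_cancel)
    moreover have "c \<otimes> x \<otimes> inv c \<in> L"
      using x G nL by (simp add: K_def normal.inv_op_closed2)
    ultimately show "c \<otimes> x \<otimes> inv c \<in> K" using VP conj[OF c wp(1)] by metis
  qed
  have "closedin T K"
    using closedin_subgroup_if_rel_open[OF clL sL opW] sK by (simp add: K_def)
  moreover have "compact_space (coset_space G T K P)"
  proof (rule compact_coset_space[OF subgroup.subset[OF sK] _ _ nP])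
    \<comment> \<open>The compact set of representatives is \<open>L \<inter> B\<close>: it contains
      \<open>L \<inter> W\<close>, and \<open>sub\<close> keeps it inside \<open>K\<close>.\<close>
    show "compactin T (L \<inter> B)" using clL B(1) by (rule closed_Int_compactin)
    show "L \<inter> B \<subseteq> K" using sub by (auto simp: K_def)
    show "K \<subseteq> (L \<inter> B) <#> P" using KQP W(3) B(2) by (fastforce simp: set_mult_def)
  qed
  moreover have "discrete_space (coset_space G T L K)"
    using discrete_coset_space[OF sL sK _ opW] by (simp add: K_def)
  ultimately show ?thesis
    using nK PK by (intro exI[of _ K]) (auto simp: closed_normal_subgroup_def K_def)
qed

section \<open>Intersections, directed unions and closures of normal subgroups\<close>

lemma closed_normal_subgroup_subset: "closed_normal_subgroup G T N \<Longrightarrow> N \<subseteq> carrier G"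
  unfolding closed_normal_subgroup_def by (metis closedin_subset topspace_eq)

lemma closed_normal_subgroup_Inter:
  assumes "\<F> \<noteq> {}" "\<And>N. N \<in> \<F> \<Longrightarrow> closed_normal_subgroup G T N"
  shows "closed_normal_subgroup G T (\<Inter>\<F>)"
proof -
  have "subgroup (\<Inter>\<F>) G"
    using assms by (intro subgroups_Inter) (auto simp: closed_normal_subgroup_def normal_imp_subgroup)
  moreover have "x \<otimes> h \<otimes> inv x \<in> \<Inter>\<F>" if "x \<in> carrier G" "h \<in> \<Inter>\<F>" for x h
    using assms that by (auto simp: closed_normal_subgroup_def normal.inv_op_closed2)
  ultimately show ?thesis
    using assms by (auto simp: closed_normal_subgroup_def intro!: normal_invI)
qed

text \<open>Directedness puts two given elements into a common member, which gives closure under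
  products. Hence the union already equals the subgroup it generates, and part (2) can work with the
  closure of the plain union.\<close>

lemma normal_directed_Union:
  assumes ne: "\<D> \<noteq> {}" and norm: "\<And>N. N \<in> \<D> \<Longrightarrow> N \<lhd> G" and dir: "directed \<D>"
  shows "\<Union>\<D> \<lhd> G"
proof (rule normal_invI[OF subgroupI])
  have sg: "\<And>N. N \<in> \<D> \<Longrightarrow> subgroup N G" using norm normal_imp_subgroup by blast
  show "\<Union>\<D> \<subseteq> carrier G" using sg subgroup.subset by blast
  show "\<Union>\<D> \<noteq> {}" using ne sg subgroup.one_closed by blast
  show "inv a \<in> \<Union>\<D>" if "a \<in> \<Union>\<D>" for a
    using that sg by (auto intro: subgroup.m_inv_closed)
  show "a \<otimes> b \<in> \<Union>\<D>" if ab: "a \<in> \<Union>\<D>" "b \<in> \<Union>\<D>" for a b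
  proof -
    obtain N M where "N \<in> \<D>" "a \<in> N" "M \<in> \<D>" "b \<in> M" using ab by blast
    then obtain E where "E \<in> \<D>" "a \<in> E" "b \<in> E" using dir unfolding directed_def by blast
    then show ?thesis using subgroup.m_closed[OF sg] by blast
  qed
  show "x \<otimes> h \<otimes> inv x \<in> \<Union>\<D>" if "x \<in> carrier G" "h \<in> \<Union>\<D>" for x h
    using that norm by (auto intro: normal.inv_op_closed2)
qed

text \<open>Division and conjugation by a fixed element are continuous and preserve
  \<open>S\<close>, so they preserve its closure. For division, the closure of
  \<open>S \<times> S\<close> is the product of the closures.\<close>

lemma closed_normal_subgroup_closure_of:
  assumes S: "S \<lhd> G"
  shows "closed_normal_subgroup G T (T closure_of S)"
proof -
  have sS: "subgroup S G" using S by (rule normal_imp_subgroup)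
  have SG: "S \<subseteq> carrier G" using sS by (rule subgroup.subset)
  have clG: "T closure_of S \<subseteq> carrier G"
    using closure_of_subset_topspace[of T S] by (simp add: topspace_eq)
  have incl: "S \<subseteq> T closure_of S" using SG by (simp add: closure_of_subset topspace_eq)
  have div: "a \<otimes> inv b \<in> T closure_of S" if "a \<in> T closure_of S" "b \<in> T closure_of S" for a b
  proof -
    let ?f = "\<lambda>z. fst z \<otimes> inv (snd z)"
    have "continuous_map (prod_topology T T) T ?f" by (intro continuous_intros_grp)
    then have "?f ` (prod_topology T T closure_of (S \<times> S)) \<subseteq> T closure_of (?f ` (S \<times> S))"
      by (rule continuous_map_image_closure_subset)
    also have "\<dots> \<subseteq> T closure_of S"
      using sS by (intro closure_of_mono) (auto simp: subgroup.m_closed subgroup.m_inv_closed)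
    finally show ?thesis using that by (force simp: closure_of_Times)
  qed
  have one: "\<one> \<in> T closure_of S" using incl sS subgroup.one_closed by blast
  have inv: "inv a \<in> T closure_of S" if "a \<in> T closure_of S" for a
    using div[OF one that] clG that by auto
  have "subgroup (T closure_of S) G"
  proof (rule subgroupI)
    show "a \<otimes> b \<in> T closure_of S" if "a \<in> T closure_of S" "b \<in> T closure_of S" for a b
      using div[OF that(1) inv[OF that(2)]] clG that by auto
  qed (use clG one inv in auto)
  moreover have "x \<otimes> h \<otimes> inv x \<in> T closure_of S"
    if x: "x \<in> carrier G" and h: "h \<in> T closure_of S" for x h
  proof -
    let ?f = "\<lambda>z. x \<otimes> z \<otimes> inv x"
    have "continuous_map T T ?f" using x by (intro continuous_intros_grp) auto
    then have "?f ` (T closure_of S) \<subseteq> T closure_of (?f ` S)"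
      by (rule continuous_map_image_closure_subset)
    also have "\<dots> \<subseteq> T closure_of S"
      using S x by (intro closure_of_mono) (auto simp: normal.inv_op_closed2)
    finally show ?thesis using h by blast
  qed
  ultimately show ?thesis by (auto simp: closed_normal_subgroup_def intro: normal_invI)
qed

lemma generate_subgroup_eq:
  assumes "subgroup S G"
  shows "generate G S = S"
  by (rule subset_antisym[OF generate_subgroup_incl[OF subset_refl assms]]) (rule subsetI, rule generate.incl)

text \<open>For x in the closure, the y with x y^{-1} in W form an open neighbourhood of x, which
  must meet S.\<close>

lemma closure_of_subset_set_mult:
  assumes W: "openin T W" "\<one> \<in> W" and S: "S \<subseteq> carrier G"
  shows "T closure_of S \<subseteq> W <#> S"
proof
  fix x assume x: "x \<in> T closure_of S"
  then have xG: "x \<in> carrier G" by (simp add: in_closure_of topspace_eq)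
  define O' where "O' = {y \<in> topspace T. x \<otimes> inv y \<in> W}"
  have "openin T O'"
    unfolding O'_def using xG by (intro openin_continuous_map_preimage[OF _ W(1)] continuous_intros_grp)
  moreover have "x \<in> O'" using xG W by (simp add: O'_def topspace_eq)
  ultimately obtain y where y: "y \<in> S" "y \<in> O'" using x by (auto simp: in_closure_of)
  have "x = (x \<otimes> inv y) \<otimes> y" using xG y S by (auto simp: m_assoc subset_iff)
  moreover have "x \<otimes> inv y \<in> W" using y by (simp add: O'_def)
  ultimately show "x \<in> W <#> S" using y(1) unfolding set_mult_def by blast
qed

section \<open>Compactness selects the member of the family\<close>

text \<open>A point of \<open>B\<close> outside \<open>\<Inter>\<F>\<close> is missed by some
  \<open>N\<close>. The open sets formed from \<open>W <#> \<Inter>\<F>\<close> and the complement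
  of \<open>N\<close> therefore cover \<open>B\<close>, and they grow as \<open>N\<close> shrinks,
  so a single one covers.\<close>

lemma filtering_small:
  assumes W: "openin T W" "\<one> \<in> W" and B: "compactin T B"
    and ne: "\<F> \<noteq> {}" and cn: "\<And>N. N \<in> \<F> \<Longrightarrow> closed_normal_subgroup G T N" and fil: "filtering \<F>"
  obtains N where "N \<in> \<F>" "N \<inter> B \<subseteq> W <#> \<Inter>\<F>"
proof -
  let ?U = "\<lambda>N. (W <#> \<Inter>\<F>) \<union> (topspace T - N)"
  have IG: "\<Inter>\<F> \<subseteq> carrier G"
    using closed_normal_subgroup_Inter[OF ne cn] closed_normal_subgroup_subset by blast
  have "\<Inter>\<F> \<subseteq> T closure_of \<Inter>\<F>" using IG by (intro closure_of_subset) (simp add: topspace_eq)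
  then have IW: "\<Inter>\<F> \<subseteq> W <#> \<Inter>\<F>" using closure_of_subset_set_mult[OF W IG] by blast
  obtain N where N: "N \<in> \<F>" "B \<subseteq> ?U N"
  proof (rule compactin_directed_cover[OF B ne, of ?U])
    show "openin T (?U N)" if "N \<in> \<F>" for N
      using openin_set_mult[OF W(1) IG] cn[OF that] by (auto simp: closed_normal_subgroup_def)
    show "\<exists>k\<in>\<F>. ?U i \<union> ?U j \<subseteq> ?U k" if "i \<in> \<F>" "j \<in> \<F>" for i j
    proof -
      obtain k where "k \<in> \<F>" "k \<subseteq> i \<inter> j" using fil \<open>i \<in> \<F>\<close> \<open>j \<in> \<F>\<close> unfolding filtering_def by blast
      then show ?thesis by (intro bexI[of _ k]) auto
    qed
    show "B \<subseteq> (\<Union>N\<in>\<F>. ?U N)" using IW compactin_subset_topspace[OF B] ne by blast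
  qed
  then show thesis using that by blast
qed

text \<open>The closure lies in \<open>W <#> \<Union>\<D>\<close>, which is the union of the sets
  \<open>W <#> N\<close>. Adding the open complement of the closure to each gives a directed cover
  of all of \<open>B\<close>, not just of its part in the closure.\<close>

lemma directed_large:
  assumes W: "openin T W" "\<one> \<in> W" and B: "compactin T B"
    and ne: "\<D> \<noteq> {}" and cn: "\<And>N. N \<in> \<D> \<Longrightarrow> closed_normal_subgroup G T N" and dir: "directed \<D>"
  obtains N where "N \<in> \<D>" "(T closure_of \<Union>\<D>) \<inter> B \<subseteq> W <#> N"
proof -
  let ?U = "\<lambda>N. (W <#> N) \<union> (topspace T - T closure_of \<Union>\<D>)"
  have NG: "N \<subseteq> carrier G" if "N \<in> \<D>" for N
    using cn[OF that] by (rule closed_normal_subgroup_subset)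
  have "T closure_of \<Union>\<D> \<subseteq> W <#> \<Union>\<D>"
    using NG by (intro closure_of_subset_set_mult[OF W]) blast
  also have "\<dots> = (\<Union>N\<in>\<D>. W <#> N)" by (auto simp: set_mult_def)
  finally have cl: "T closure_of \<Union>\<D> \<subseteq> (\<Union>N\<in>\<D>. W <#> N)" .
  obtain N where N: "N \<in> \<D>" "B \<subseteq> ?U N"
  proof (rule compactin_directed_cover[OF B ne, of ?U])
    show "openin T (?U N)" if "N \<in> \<D>" for N
      using openin_set_mult[OF W(1) NG[OF that]]
      by (intro openin_Un openin_diff openin_topspace closedin_closure_of)
    show "\<exists>k\<in>\<D>. ?U i \<union> ?U j \<subseteq> ?U k" if "i \<in> \<D>" "j \<in> \<D>" for i j
    proof -
      obtain k where "k \<in> \<D>" "i \<union> j \<subseteq> k" using dir \<open>i \<in> \<D>\<close> \<open>j \<in> \<D>\<close> unfolding directed_def by blast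
      then show ?thesis by (intro bexI[of _ k]) (auto simp: set_mult_def)
    qed
    show "B \<subseteq> (\<Union>N\<in>\<D>. ?U N)" using cl compactin_subset_topspace[OF B] ne by blast
  qed
  then show thesis using that by blast
qed

end

theorem mainTheorem6:
  fixes G :: "('a, 'b) monoid_scheme" and T :: "'a topology"
  assumes "locally_compact_group G T"
    and "compactly_generated G T"
  shows "(\<forall>\<F>. \<F> \<noteq> {} \<and> (\<forall>N\<in>\<F>. closed_normal_subgroup G T N) \<and> filtering \<F> \<longrightarrow>
            (\<exists>N\<in>\<F>. \<exists>K. closed_normal_subgroup G T K \<and> \<Inter>\<F> \<subseteq> K \<and> K \<subseteq> N \<and>
               compact_space (coset_space G T K (\<Inter>\<F>)) \<and>
               discrete_space (coset_space G T N K))) \<and>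
         (\<forall>\<D>. \<D> \<noteq> {} \<and> (\<forall>N\<in>\<D>. closed_normal_subgroup G T N) \<and> directed \<D> \<longrightarrow>
            (\<exists>N\<in>\<D>. \<exists>K. closed_normal_subgroup G T K \<and> N \<subseteq> K \<and>
               K \<subseteq> T closure_of (generate G (\<Union>\<D>)) \<and>
               compact_space (coset_space G T K N) \<and>
               discrete_space (coset_space G T (T closure_of (generate G (\<Union>\<D>))) K)))"
proof -
  interpret topological_grp G T
    using assms(1) by (simp add: topological_grp_def topological_grp_axioms_def
        locally_compact_group_def topological_group_def)
  have lc: "locally_compact_space T" using assms(1) by (simp add: locally_compact_group_def)
  obtain C where C: "compactin T C" "generate G C = carrier G"
    using assms(2) by (auto simp: compactly_generated_def)
  have CG: "C \<subseteq> carrier G" using compactin_subset_topspace[OF C(1)] by (simp add: topspace_eq)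
  \<comment> \<open>The generating set is symmetrised so that conjugation by inverse generators is
    controlled too, as \<open>normalI_generators\<close> demands.\<close>
  have "compactin T (m_inv G ` C)"
    using C(1) by (rule image_compactin) (intro continuous_intros_grp)
  then have CC: "compactin T (C \<union> m_inv G ` C)" using C(1) by (simp add: compactin_Un)
  obtain V W B where nb: "openin T W" "\<one>\<^bsub>G\<^esub> \<in> W" "compactin T B" "V \<subseteq> B" "W \<subseteq> V"
    and div: "\<And>x y. x \<in> W \<Longrightarrow> y \<in> W \<Longrightarrow> x \<otimes>\<^bsub>G\<^esub> inv\<^bsub>G\<^esub> y \<in> V"
    and conj: "\<And>c x. c \<in> C \<union> m_inv G ` C \<Longrightarrow> x \<in> W \<Longrightarrow> c \<otimes>\<^bsub>G\<^esub> x \<otimes>\<^bsub>G\<^esub> inv\<^bsub>G\<^esub> c \<in> V"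
    using exists_core_nbhds[OF lc CC] by metis
  have core: "\<exists>K. closed_normal_subgroup G T K \<and> P \<subseteq> K \<and> K \<subseteq> L \<and>
      compact_space (coset_space G T K P) \<and> discrete_space (coset_space G T L K)"
    if "closed_normal_subgroup G T P" "closed_normal_subgroup G T L" "P \<subseteq> L" "L \<inter> B \<subseteq> W <#>\<^bsub>G\<^esub> P"
    for P L
    using compact_by_discrete[OF nb(1,2,5,3,4) _ _ CG C(2) that] div conj by blast
  show ?thesis
  proof (intro conjI allI impI; elim conjE)
    fix \<F> :: "'a set set"
    assume \<F>: "\<F> \<noteq> {}" "\<forall>N\<in>\<F>. closed_normal_subgroup G T N" "filtering \<F>"
    then obtain N where N: "N \<in> \<F>" "N \<inter> B \<subseteq> W <#>\<^bsub>G\<^esub> \<Inter>\<F>"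
      using filtering_small[OF nb(1,2,3)] by metis
    have "closed_normal_subgroup G T (\<Inter>\<F>)"
      using \<F> closed_normal_subgroup_Inter by blast
    with core[OF this _ _ N(2)] N \<F>
    show "\<exists>N\<in>\<F>. \<exists>K. closed_normal_subgroup G T K \<and> \<Inter>\<F> \<subseteq> K \<and> K \<subseteq> N \<and>
               compact_space (coset_space G T K (\<Inter>\<F>)) \<and> discrete_space (coset_space G T N K)"
      by (meson Inter_lower)
  next
    fix \<D> :: "'a set set"
    assume \<D>: "\<D> \<noteq> {}" "\<forall>N\<in>\<D>. closed_normal_subgroup G T N" "directed \<D>"
    then obtain N where N: "N \<in> \<D>" "(T closure_of \<Union>\<D>) \<inter> B \<subseteq> W <#>\<^bsub>G\<^esub> N"
      using directed_large[OF nb(1,2,3)] by metis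
    have normU: "\<Union>\<D> \<lhd> G"
      using \<D> by (intro normal_directed_Union) (auto simp: closed_normal_subgroup_def)
    have "\<Union>\<D> \<subseteq> topspace T"
      using \<D>(2) closed_normal_subgroup_subset by (auto simp: topspace_eq)
    then have "\<Union>\<D> \<subseteq> T closure_of \<Union>\<D>"
      by (rule closure_of_subset)
    then have "N \<subseteq> T closure_of \<Union>\<D>" using N(1) by blast
    with core[OF _ closed_normal_subgroup_closure_of[OF normU] _ N(2)] N \<D>
    show "\<exists>N\<in>\<D>. \<exists>K. closed_normal_subgroup G T K \<and> N \<subseteq> K \<and>
               K \<subseteq> T closure_of (generate G (\<Union>\<D>)) \<and> compact_space (coset_space G T K N) \<and>
               discrete_space (coset_space G T (T closure_of (generate G (\<Union>\<D>))) K)"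
      \<comment> \<open>\<open>\<Union>\<D>\<close> is a subgroup, so \<open>generate\<close>
        disappears from the goal and the closure matches the \<open>L\<close> given to
        \<open>core\<close>.\<close>
      unfolding generate_subgroup_eq[OF normal_imp_subgroup[OF normU]] by meson
  qed
qed

end
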